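(* Let $\mathcal{A}=\{A_1,\dots,A_m\}$ be an irreducible finite family of real $d\times d$ matrices that possesses a common invariant cone $K$. Then the Perron eigenvector of the mean matrix $\bar A=\frac1m\sum_{i=1}^m A_i$ (with respect to its invariant cone $K$) is simple and belongs to $\operatorname{int} K$.
   Context: A cone $K\subset\mathbb{R}^d$ is a closed convex cone with apex at the origin that is proper, i.e. it has nonempty interior and $K\cap(-K)=\{0\}$. $K$ is a (common) invariant cone of a family $\mathcal{A}$ if $AK\subset K$ for all $A\in\mathcal{A}$. A family of matrices is irreducible if its matrices have no common invariant linear subspace other than $\{0\}$ and $\mathbb{R}^d$. $\rho(A)$ is the spectral radius. A leading (Perron) eigenvalue of $A$ is an eigenvalue equal to $\rho(A)$; a corresponding nonzero eigenvector is a leading eigenvector. If $A$ has an invariant cone $K$, its leading eigenvectors lying in $K$ are called Perron eigenvectors (they exist by the Krein–Rutman theorem). A Perron (or leading) eigenvector is simple if it is the unique, up to multiplication by a constant, eigenvector corresponding to the Perron (leading) eigenvalue. *)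

theory Defs
  imports "HOL-Analysis.Analysis"
begin

definition is_eigenvector :: "'a::field^'n^'n \<Rightarrow> 'a^'n \<Rightarrow> 'a \<Rightarrow> bool" where
  "is_eigenvector A v k \<longleftrightarrow> v \<noteq> 0 \<and> A *v v = k *s v"

definition matrix_spectrum :: "complex^'n^'n \<Rightarrow> complex set" where
  "matrix_spectrum A = {k. \<exists>v. is_eigenvector A v k}"

text \<open>The spectral radius of a real matrix takes all complex eigenvalues into account,
  hence the complexification of the entries.\<close>

definition matrix_spectral_radius :: "real^'n^'n \<Rightarrow> real" where
  "matrix_spectral_radius A = Max (cmod ` matrix_spectrum (map_matrix complex_of_real A))"

definition proper_cone :: "(real^'n) set \<Rightarrow> bool" where
  "proper_cone K \<longleftrightarrow> closed K \<and> convex_cone K \<and> interior K \<noteq> {} \<and> K \<inter> uminus ` K = {0}"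

definition common_invariant_cone :: "(real^'n^'n) set \<Rightarrow> (real^'n) set \<Rightarrow> bool" where
  "common_invariant_cone F K \<longleftrightarrow> proper_cone K \<and> (\<forall>A\<in>F. (*v) A ` K \<subseteq> K)"

definition irreducible_family :: "(real^'n^'n) set \<Rightarrow> bool" where
  "irreducible_family F \<longleftrightarrow>
     (\<forall>V. subspace V \<and> (\<forall>A\<in>F. (*v) A ` V \<subseteq> V) \<longrightarrow> V = {0} \<or> V = UNIV)"

definition leading_eigenvector :: "real^'n^'n \<Rightarrow> real^'n \<Rightarrow> bool" where
  "leading_eigenvector A v \<longleftrightarrow> is_eigenvector A v (matrix_spectral_radius A)"

definition perron_eigenvector :: "(real^'n) set \<Rightarrow> real^'n^'n \<Rightarrow> real^'n \<Rightarrow> bool" where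
  "perron_eigenvector K A v \<longleftrightarrow> leading_eigenvector A v \<and> v \<in> K"

text \<open>Uniqueness up to scaling is among all leading eigenvectors, not only among those in a
  given cone.\<close>

definition simple_leading_eigenvector :: "real^'n^'n \<Rightarrow> real^'n \<Rightarrow> bool" where
  "simple_leading_eigenvector A v \<longleftrightarrow>
     leading_eigenvector A v \<and> (\<forall>w. leading_eigenvector A w \<longrightarrow> (\<exists>c. w = c *\<^sub>R v))"

definition mean_matrix :: "nat \<Rightarrow> (nat \<Rightarrow> real^'n^'n) \<Rightarrow> real^'n^'n" where
  "mean_matrix m A = (1 / real m) *\<^sub>R (\<Sum>i=1..m. A i)"

end

theory Submission
  imports Defs
begin

text \<open>
  Write \<open>M\<close> for the mean matrix; it preserves the cone \<open>K\<close>. The proof separates what is true of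
  every matrix preserving a proper cone from what irreducibility adds, namely that every
  eigenvector of \<open>M\<close> in \<open>K\<close> is interior to \<open>K\<close>.

  Irreducibility enters only in \<open>irreducible_sum_eigenvector_interior\<close>. Order the space by
  \<open>x \<le> y\<close> iff \<open>y - x \<in> K\<close>. If \<open>v\<close> is an eigenvector of \<open>\<Sum> A\<^sub>i\<close> in \<open>K\<close>, then each \<open>A\<^sub>i v\<close> is one of
  several summands in \<open>K\<close> that add up to a multiple of \<open>v\<close>, so it is dominated by a multiple of
  \<open>v\<close>. Hence the vectors lying between two multiples of \<open>v\<close> form a nonzero subspace invariant
  under the whole family. This subspace is everything, so a multiple of \<open>v\<close> dominates an
  interior point of \<open>K\<close>, and \<open>v\<close> is itself interior.

  An eigenvector \<open>v\<close> in \<open>K\<close> exists by Brouwer's theorem, applied to the normalised action of \<open>M\<close> on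
  a compact slice of \<open>K\<close> (\<open>cone_preserving_eigenvector_exists\<close>). Since \<open>v\<close> is interior, every
  vector lies between two multiples of \<open>v\<close>; applying powers of \<open>M\<close> to these inequalities shows that
  no orbit grows faster than the powers of the eigenvalue \<open>l\<close> of \<open>v\<close>, so no complex eigenvalue exceeds
  \<open>l\<close> in modulus, and \<open>l\<close> is the spectral radius (\<open>cone_preserving_spectral_radius\<close>).

  Simplicity follows from interiority again (\<open>eigenspace_one_dimensional\<close>): if \<open>w\<close> were a second,
  independent eigenvector for \<open>l\<close>, the line through \<open>v\<close> in direction \<open>w\<close> would meet the boundary
  of \<open>K\<close> in a nonzero vector, which would be an eigenvector that is not interior.
\<close>

section \<open>Eigenvalues of a matrix\<close>

text \<open>Applying \<open>A\<close> to a vanishing combination and subtracting \<open>k0\<close> times that combination kills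
  the term of \<open>k0\<close> and multiplies each other coefficient by the nonzero number \<open>k - k0\<close>.\<close>

lemma eigenvectors_linearly_independent:
  fixes A :: "'a::field^'n^'n"
  assumes "finite S" "\<And>k. k \<in> S \<Longrightarrow> is_eigenvector A (f k) k" "(\<Sum>k\<in>S. c k *s f k) = 0"
  shows "\<forall>k\<in>S. c k = 0"
  using assms
proof (induction S arbitrary: c rule: finite_induct)
  case empty
  then show ?case by simp
next
  case (insert k0 S)
  have ev: "A *v f k = k *s f k" "f k \<noteq> 0" if "k \<in> insert k0 S" for k
    using insert.prems(1)[OF that] by (auto simp: is_eigenvector_def)
  have "A *v (\<Sum>k\<in>insert k0 S. c k *s f k) = (\<Sum>k\<in>insert k0 S. c k *s (k *s f k))"
    by (simp only: vec.sum vec.scale) (rule sum.cong, simp_all only: ev)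
  then have "(\<Sum>k\<in>insert k0 S. c k *s (k *s f k)) = 0"
    using insert.prems(2) by simp
  moreover have "(\<Sum>k\<in>insert k0 S. k0 *s (c k *s f k)) = 0"
    using insert.prems(2) by (simp only: vec.scale_sum_right[symmetric]) simp
  ultimately have "(\<Sum>k\<in>insert k0 S. c k *s (k *s f k) - k0 *s (c k *s f k)) = 0"
    by (simp only: sum_subtractf) simp
  moreover have "c k *s (k *s f k) - k0 *s (c k *s f k) = (c k * (k - k0)) *s f k" for k
    by (simp add: vec_eq_iff algebra_simps)
  ultimately have "(\<Sum>k\<in>S. (c k * (k - k0)) *s f k) = 0"
    using insert.hyps by simp
  then have "\<forall>k\<in>S. c k * (k - k0) = 0"
    using insert.IH[of "\<lambda>k. c k * (k - k0)"] insert.prems(1) by blast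
  then have S0: "\<forall>k\<in>S. c k = 0"
    using insert.hyps(2) by auto
  then have "(\<Sum>k\<in>S. c k *s f k) = 0"
    by (simp add: sum.neutral)
  then have "c k0 *s f k0 = 0"
    using insert.prems(2) insert.hyps by simp
  then show ?case
    using S0 ev(2)[of k0] by simp
qed

text \<open>The spectral radius is a \<^const>\<open>Max\<close>, which says something only about finite sets.\<close>

lemma finite_matrix_spectrum: "finite (matrix_spectrum A)"
proof (rule ccontr)
  assume "infinite (matrix_spectrum A)"
  then obtain S where S: "S \<subseteq> matrix_spectrum A" "finite S" "card S = Suc (CARD('a))"
    using infinite_arbitrarily_large by metis
  then have "\<forall>k\<in>S. \<exists>v. is_eigenvector A v k"
    by (auto simp: matrix_spectrum_def)
  then obtain f where f: "\<And>k. k \<in> S \<Longrightarrow> is_eigenvector A (f k) k"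
    by metis
  have inj: "inj_on f S"
    using f by (intro inj_onI) (metis is_eigenvector_def vector_mul_rcancel)
  have "vec.independent (f ` S)"
  proof (rule vec.independent_if_scalars_zero)
    show "finite (f ` S)" using S by simp
  next
    fix c x assume "(\<Sum>x\<in>f ` S. c x *s x) = 0" "x \<in> f ` S"
    then show "c x = 0"
      using eigenvectors_linearly_independent[of S A f "c \<circ> f"] f S(2) inj
      by (auto simp: sum.reindex)
  qed
  then have "card (f ` S) \<le> CARD('a)"
    using vec.independent_bound_general[of "f ` S"] vec.dim_subset_UNIV[of "f ` S"]
    by (simp add: vec.dimension_def card_cart_basis)
  then show False
    using S card_image[OF inj] by simp
qed

lemma real_eigenvalue_in_complex_spectrum:
  assumes "is_eigenvector M v l"
  shows "complex_of_real l \<in> matrix_spectrum (map_matrix complex_of_real M)"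
proof -
  let ?z = "(\<chi> i. complex_of_real (v $ i))"
  have "(M *v v) $ i = l * v $ i" for i
    using assms by (simp add: is_eigenvector_def)
  then have "map_matrix complex_of_real M *v ?z = complex_of_real l *s ?z"
    by (simp add: vec_eq_iff matrix_vector_mult_def flip: of_real_mult of_real_sum)
  moreover have "?z \<noteq> 0"
    using assms by (auto simp: is_eigenvector_def vec_eq_iff)
  ultimately show ?thesis
    by (auto simp: matrix_spectrum_def is_eigenvector_def)
qed

lemma matrix_vector_mult_sum_left:
  fixes A :: "'i \<Rightarrow> 'a::semiring_1^'n^'m"
  shows "(\<Sum>i\<in>I. A i) *v x = (\<Sum>i\<in>I. A i *v x)"
  by (induction I rule: infinite_finite_induct) (simp_all add: matrix_vector_mult_add_rdistrib)

section \<open>Proper cones\<close>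

lemma convex_cone_sum:
  assumes "convex_cone K" "\<And>i. i \<in> I \<Longrightarrow> f i \<in> K"
  shows "sum f I \<in> K"
  using assms(2)
  by (induction I rule: infinite_finite_induct)
    (auto intro: convex_cone_add[OF assms(1)] convex_cone_contains_0[OF assms(1)])

lemma proper_cone_dest:
  assumes "proper_cone K"
  shows "closed K" "convex K" "convex_cone K" "interior K \<noteq> {}" "0 \<in> K"
    and "\<And>x. x \<in> K \<Longrightarrow> - x \<in> K \<Longrightarrow> x = 0"
proof -
  show "closed K" "convex_cone K" "interior K \<noteq> {}" "convex K" "0 \<in> K"
    using assms by (auto simp: proper_cone_def convex_cone_def intro: convex_cone_contains_0)
  fix x assume "x \<in> K" "- x \<in> K"
  then have "x \<in> K \<inter> uminus ` K" by force
  then show "x = 0" using assms unfolding proper_cone_def by blast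
qed

text \<open>The cone without its apex is convex, because \<open>K\<close> contains no line; hence it contains the
  convex hull of the compact set of unit vectors of \<open>K\<close>, and a hyperplane separates that hull
  from \<open>0\<close>. The functional makes the slices of \<open>K\<close> compact, and it turns order bounds into norm
  bounds.\<close>

lemma proper_cone_positive_functional:
  assumes K: "proper_cone K"
  obtains a b where "b > 0" "\<And>x. x \<in> K \<Longrightarrow> b * norm x \<le> a \<bullet> x"
proof -
  note Kd = proper_cone_dest[OF K]
  let ?S = "K \<inter> sphere 0 1"
  have "convex (K - {0})"
  proof (rule convexI)
    fix x y and u v :: real
    assume h: "x \<in> K - {0}" "y \<in> K - {0}" "0 \<le> u" "0 \<le> v" "u + v = 1"
    have uv: "u *\<^sub>R x \<in> K" "v *\<^sub>R y \<in> K"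
      using h Kd(3) by (auto intro: convex_cone_scaleR)
    moreover have "u *\<^sub>R x + v *\<^sub>R y \<noteq> 0"
    proof
      assume "u *\<^sub>R x + v *\<^sub>R y = 0"
      then have "- (u *\<^sub>R x) = v *\<^sub>R y" "- (v *\<^sub>R y) = u *\<^sub>R x"
        by (simp_all add: eq_neg_iff_add_eq_0 neg_eq_iff_add_eq_0 add.commute)
      then have "u *\<^sub>R x = 0" "v *\<^sub>R y = 0"
        using Kd(6) uv by metis+
      then show False using h by auto
    qed
    ultimately show "u *\<^sub>R x + v *\<^sub>R y \<in> K - {0}"
      using Kd(3) by (auto intro: convex_cone_add)
  qed
  then have "convex hull ?S \<subseteq> K - {0}"
    by (intro hull_minimal) auto
  then have "0 \<notin> convex hull ?S" by blast
  moreover have "compact (convex hull ?S)"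
    using Kd(1) by (intro compact_convex_hull closed_Int_compact) auto
  ultimately obtain a b where ab: "0 < b" "\<And>x. x \<in> convex hull ?S \<Longrightarrow> b < a \<bullet> x"
    using separating_hyperplane_closed_0[OF convex_convex_hull compact_imp_closed, of ?S] by blast
  have "b * norm x \<le> a \<bullet> x" if "x \<in> K" for x
  proof (cases "x = 0")
    case False
    have "(1 / norm x) *\<^sub>R x \<in> ?S"
      using that False Kd(3) by (auto intro!: convex_cone_scaleR)
    then have "b < a \<bullet> ((1 / norm x) *\<^sub>R x)"
      by (intro ab(2) hull_inc)
    then show ?thesis using False by (simp add: field_simps)
  qed simp
  then show ?thesis using ab(1) that by blast
qed

text \<open>In the order given by \<open>K\<close>, the interior points of \<open>K\<close> are exactly its order units. The next
  two lemmas are the two directions; for the converse it suffices that a multiple of \<open>v\<close> dominates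
  a single interior point \<open>w\<close>, since translating a ball around \<open>w\<close> by an element of \<open>K\<close> stays
  in \<open>K\<close>.\<close>

lemma interior_point_absorbs:
  fixes v x :: "'a::real_normed_vector"
  assumes "convex_cone K" "v \<in> interior K"
  obtains t where "t \<ge> 0" "t *\<^sub>R v + x \<in> K" "t *\<^sub>R v - x \<in> K"
proof -
  obtain e where e: "e > 0" "cball v e \<subseteq> K"
    using assms(2) mem_interior_cball by blast
  define t where "t = norm x / e"
  have t: "t \<ge> 0" using e(1) by (simp add: t_def)
  have *: "t *\<^sub>R v + y \<in> K" if "norm y = norm x" for y
  proof (cases "x = 0")
    case True
    then show ?thesis using that convex_cone_contains_0[OF assms(1)] by (simp add: t_def)
  next
    case False
    then have tp: "t > 0" using e(1) by (simp add: t_def)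
    have "v + (1 / t) *\<^sub>R y \<in> cball v e"
      using that e(1) False by (simp add: dist_norm t_def)
    then have "t *\<^sub>R (v + (1 / t) *\<^sub>R y) \<in> K"
      using e(2) t assms(1) by (blast intro: convex_cone_scaleR)
    then show ?thesis using tp by (simp add: scaleR_add_right)
  qed
  show ?thesis
    using that[OF t *[of x]] *[of "- x"] by simp
qed

lemma absorbing_point_interior:
  fixes v w :: "'a::real_normed_vector"
  assumes K: "convex_cone K" and w: "w \<in> interior K"
    and t: "t *\<^sub>R v - w \<in> K" "t > 0"
  shows "v \<in> interior K"
proof -
  obtain e where e: "e > 0" "ball w e \<subseteq> K"
    using w mem_interior by blast
  have "ball v (e / t) \<subseteq> K"
  proof
    fix y assume "y \<in> ball v (e / t)"
    then have "norm (y - v) < e / t" by (simp add: dist_norm norm_minus_commute)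
    then have "norm (t *\<^sub>R (y - v)) < e"
      using t(2) by (simp add: pos_less_divide_eq mult.commute)
    then have "w + t *\<^sub>R (y - v) \<in> ball w e"
      by (simp add: dist_norm)
    then have "(w + t *\<^sub>R (y - v)) + (t *\<^sub>R v - w) \<in> K"
      using e(2) by (intro convex_cone_add[OF K _ t(1)]) blast
    then have "t *\<^sub>R y \<in> K" by (simp add: algebra_simps)
    then have "(1 / t) *\<^sub>R (t *\<^sub>R y) \<in> K"
      using t(2) by (intro convex_cone_scaleR[OF K _ \<open>t *\<^sub>R y \<in> K\<close>]) simp
    then show "y \<in> K" using t(2) by simp
  qed
  moreover have "e / t > 0" using e(1) t(2) by simp
  ultimately show ?thesis unfolding mem_interior by blast
qed

section \<open>Perron--Frobenius theory for a matrix preserving a cone\<close>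

text \<open>If \<open>M\<close> kills a nonzero vector of \<open>K\<close>, that vector will do. Otherwise a positive
  functional \<open>a\<close> stays positive on the image of \<open>K\<close>, so rescaling \<open>M x\<close> back to \<open>a \<bullet> x = 1\<close> is a continuous
  self-map of a compact convex slice of \<open>K\<close>, whose fixed points are eigenvectors.\<close>

lemma cone_preserving_eigenvector_exists:
  fixes M :: "real^'n^'n"
  assumes K: "proper_cone K" and M: "\<And>x. x \<in> K \<Longrightarrow> M *v x \<in> K"
  obtains v l where "v \<in> K" "v \<noteq> 0" "l \<ge> 0" "M *v v = l *\<^sub>R v"
proof (cases "\<exists>v\<in>K. v \<noteq> 0 \<and> M *v v = 0")
  case True
  then show ?thesis using that[of _ 0] by auto
next
  case False
  note Kd = proper_cone_dest[OF K]
  obtain a b where ab: "b > 0" "\<And>x. x \<in> K \<Longrightarrow> b * norm x \<le> a \<bullet> x"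
    using proper_cone_positive_functional[OF K] by blast
  have pos: "a \<bullet> x > 0" if "x \<in> K" "x \<noteq> 0" for x
    using ab(1) ab(2)[OF that(1)] that(2) by (smt (verit) mult_pos_pos zero_less_norm_iff)
  define S where "S = K \<inter> {x. a \<bullet> x = 1}"
  define g where "g x = (1 / (a \<bullet> (M *v x))) *\<^sub>R (M *v x)" for x
  have Mpos: "a \<bullet> (M *v x) > 0" if "x \<in> S" for x
    using that False M by (intro pos) (auto simp: S_def)
  have "norm x \<le> 1 / b" if "x \<in> S" for x
    using ab(1) ab(2)[of x] that by (simp add: S_def field_simps)
  then have "bounded S" by (auto simp: bounded_iff)
  moreover have "closed S"
    unfolding S_def by (intro closed_Int Kd closed_hyperplane)
  ultimately have cS: "compact S" by (simp add: compact_eq_bounded_closed)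
  have convS: "convex S"
    unfolding S_def by (intro convex_Int Kd convex_hyperplane)
  have "\<exists>x\<in>K. x \<noteq> 0"
  proof (rule ccontr)
    assume "\<not> (\<exists>x\<in>K. x \<noteq> 0)"
    then have "interior K \<subseteq> interior {0}" by (intro interior_mono) auto
    then show False using Kd(4) by simp
  qed
  then obtain x0 where x0: "x0 \<in> K" "x0 \<noteq> 0" by blast
  have "(1 / (a \<bullet> x0)) *\<^sub>R x0 \<in> S"
    using pos[OF x0] x0 Kd(3) by (auto simp: S_def intro!: convex_cone_scaleR)
  then have neS: "S \<noteq> {}" by blast
  have "continuous_on S ((*v) M)"
    by (intro linear_continuous_on matrix_vector_mul_bounded_linear)
  moreover have "\<forall>x\<in>S. a \<bullet> (M *v x) \<noteq> 0"
    using Mpos by (metis less_irrefl)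
  ultimately have contg: "continuous_on S g"
    unfolding g_def by (intro continuous_intros)
  have "g \<in> S \<rightarrow> S"
  proof
    fix x assume x: "x \<in> S"
    then have "M *v x \<in> K" using M by (simp add: S_def)
    then show "g x \<in> S"
      using Mpos[OF x] Kd(3) by (auto simp: g_def S_def intro!: convex_cone_scaleR)
  qed
  then obtain v where v: "v \<in> S" "g v = v"
    using brouwer[OF cS convS neS contg] by blast
  have "M *v v = (a \<bullet> (M *v v)) *\<^sub>R g v"
    using Mpos[OF v(1)] by (simp add: g_def)
  then have "M *v v = (a \<bullet> (M *v v)) *\<^sub>R v" using v(2) by simp
  moreover have "v \<in> K" "v \<noteq> 0" using v(1) by (auto simp: S_def)
  ultimately show ?thesis
    using that[of v "a \<bullet> (M *v v)"] Mpos[OF v(1)] by simp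
qed

text \<open>The inequalities \<open>- t v \<le> x \<le> t v\<close> persist under \<open>M\<close>, with \<open>t v\<close> becoming \<open>t l\<^sup>k v\<close> after \<open>k\<close>
  steps; a positive functional converts them into norm bounds.\<close>

lemma cone_preserving_iterates_bounded:
  fixes M :: "real^'n^'n"
  assumes K: "proper_cone K" and M: "\<And>x. x \<in> K \<Longrightarrow> M *v x \<in> K"
    and v: "v \<in> interior K" "M *v v = l *\<^sub>R v"
  obtains C where "\<And>k. norm (((*v) M ^^ k) x) \<le> C * l ^ k"
proof -
  note Kd = proper_cone_dest[OF K]
  obtain a b where ab: "b > 0" "\<And>x. x \<in> K \<Longrightarrow> b * norm x \<le> a \<bullet> x"
    using proper_cone_positive_functional[OF K] by blast
  obtain t where t: "t *\<^sub>R v + x \<in> K" "t *\<^sub>R v - x \<in> K"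
    by (rule interior_point_absorbs[OF Kd(3) v(1), of x])
  let ?u = "\<lambda>k. (t * l ^ k) *\<^sub>R v" and ?x = "\<lambda>k. ((*v) M ^^ k) x"
  have "norm (?x k) \<le> (t * (a \<bullet> v) / b) * l ^ k" for k
  proof -
    have in_K: "?u k + ?x k \<in> K \<and> ?u k - ?x k \<in> K"
    proof (induction k)
      case 0
      then show ?case using t by simp
    next
      case (Suc k)
      have "M *v ?u k = ?u (Suc k)"
        using v(2) by (simp add: matrix_vector_mult_scaleR mult_ac)
      then show ?case
        using M[of "?u k + ?x k"] M[of "?u k - ?x k"] Suc
        by (simp del: power_Suc scaleR_scaleR add: matrix_vector_right_distrib matrix_vector_mult_diff_distrib)
    qed
    have "(p + y) - (p - y) = 2 *\<^sub>R y" for p y :: "real^'n"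
      by (simp add: scaleR_2)
    then have "2 * norm (?x k) = norm ((?u k + ?x k) - (?u k - ?x k))"
      by (simp only: norm_scaleR abs_numeral)
    also have "\<dots> \<le> norm (?u k + ?x k) + norm (?u k - ?x k)"
      by (rule norm_triangle_ineq4)
    finally have "b * (2 * norm (?x k)) \<le> b * norm (?u k + ?x k) + b * norm (?u k - ?x k)"
      using ab(1) by (simp only: distrib_left[symmetric] mult_le_cancel_left_pos)
    also have "\<dots> \<le> a \<bullet> (?u k + ?x k) + a \<bullet> (?u k - ?x k)"
      using in_K by (intro add_mono ab(2)) auto
    also have "\<dots> = 2 * (t * l ^ k * (a \<bullet> v))"
      by (simp add: inner_add_right inner_diff_right)
    finally have "b * norm (?x k) \<le> t * l ^ k * (a \<bullet> v)" by simp
    then have "norm (?x k) \<le> t * l ^ k * (a \<bullet> v) / b"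
      using ab(1) by (simp only: pos_le_divide_eq mult.commute[of _ b])
    then show ?thesis by (simp add: mult_ac)
  qed
  then show ?thesis using that by blast
qed

lemma power_bound_imp_le:
  fixes p l c C :: real
  assumes "\<And>k. p ^ k * c \<le> C * l ^ k" "c > 0" "l \<ge> 0"
  shows "p \<le> l"
proof (rule ccontr)
  assume "\<not> p \<le> l"
  then have pl: "l < p" "p > 0" using assms(3) by auto
  then have lim: "(\<lambda>k. C * (l / p) ^ k) \<longlonglongrightarrow> C * 0"
    using assms(3) by (intro tendsto_intros LIMSEQ_realpow_zero) auto
  have "c \<le> C * (l / p) ^ k" for k
    using assms(1)[of k] pl by (simp add: power_divide pos_le_divide_eq mult.commute)
  then have "c \<le> C * 0"
    by (intro LIMSEQ_le_const[OF lim]) blast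
  then show False using assms(2) by simp
qed

text \<open>Iterating \<open>M\<close> on a complex eigenvector scales it by \<open>\<mu>\<^sup>k\<close>, while the growth bound for real
  vectors applies to its real and imaginary parts.\<close>

lemma cone_preserving_spectrum_bound:
  fixes M :: "real^'n^'n"
  assumes K: "proper_cone K" and M: "\<And>x. x \<in> K \<Longrightarrow> M *v x \<in> K"
    and v: "v \<in> interior K" "M *v v = l *\<^sub>R v" "l \<ge> 0"
    and mu: "\<mu> \<in> matrix_spectrum (map_matrix complex_of_real M)"
  shows "cmod \<mu> \<le> l"
proof -
  let ?M = "map_matrix complex_of_real M"
  define R where "R w = (\<chi> i. Re (w $ i))" for w :: "complex^'n"
  have R: "R (?M *v w) = M *v R w" for w
    by (simp add: R_def vec_eq_iff matrix_vector_mult_def)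
  have bound: "\<exists>C. \<forall>k j. \<bar>Re (\<mu> ^ k * z $ j)\<bar> \<le> C * l ^ k" if z: "?M *v z = \<mu> *s z" for z
  proof -
    have iter: "((*v) M ^^ k) (R z) = R (\<mu> ^ k *s z)" for k
    proof (induction k)
      case (Suc k)
      have "?M *v (\<mu> ^ k *s z) = \<mu> ^ Suc k *s z"
        using z by (simp add: vec.scale vector_smult_assoc mult.commute)
      then show ?case using Suc R[of "\<mu> ^ k *s z"] by simp
    qed simp
    obtain C where C: "\<And>k. norm (((*v) M ^^ k) (R z)) \<le> C * l ^ k"
      using cone_preserving_iterates_bounded[OF K M v(1,2)] by blast
    have "\<bar>Re (\<mu> ^ k * z $ j)\<bar> \<le> C * l ^ k" for k j
    proof -
      have "\<bar>Re (\<mu> ^ k * z $ j)\<bar> = \<bar>R (\<mu> ^ k *s z) $ j\<bar>" by (simp add: R_def)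
      also have "\<dots> \<le> norm (R (\<mu> ^ k *s z))" by (rule component_le_norm_cart)
      also have "\<dots> \<le> C * l ^ k" using C[of k] by (simp only: iter)
      finally show ?thesis .
    qed
    then show ?thesis by blast
  qed
  obtain z where z: "z \<noteq> 0" "?M *v z = \<mu> *s z"
    using mu by (auto simp: matrix_spectrum_def is_eigenvector_def)
  then obtain j where j: "z $ j \<noteq> 0" by (auto simp: vec_eq_iff)
  \<comment> \<open>The imaginary part of \<open>z\<close> is the real part of the eigenvector \<open>- \<i> z\<close>.\<close>
  have "?M *v (- \<i> *s z) = \<mu> *s (- \<i> *s z)"
    by (simp only: vec.scale vector_smult_assoc z(2) mult.commute)
  then obtain C1 C2 where
    C1: "\<And>k. \<bar>Re (\<mu> ^ k * z $ j)\<bar> \<le> C1 * l ^ k" and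
    C2: "\<And>k. \<bar>Re (\<mu> ^ k * (- \<i> *s z) $ j)\<bar> \<le> C2 * l ^ k"
    using bound z(2) by metis
  have "cmod \<mu> ^ k * cmod (z $ j) \<le> (C1 + C2) * l ^ k" for k
  proof -
    have "cmod \<mu> ^ k * cmod (z $ j) = cmod (\<mu> ^ k * z $ j)"
      by (simp add: norm_mult norm_power)
    also have "\<dots> \<le> \<bar>Re (\<mu> ^ k * z $ j)\<bar> + \<bar>Im (\<mu> ^ k * z $ j)\<bar>"
      by (rule cmod_le)
    also have "Im (\<mu> ^ k * z $ j) = Re (\<mu> ^ k * (- \<i> *s z) $ j)"
      by (simp add: algebra_simps)
    finally show ?thesis using C1[of k] C2[of k] by (simp add: distrib_right)
  qed
  then show ?thesis
    using power_bound_imp_le[of "cmod \<mu>" "cmod (z $ j)" "C1 + C2" l] j v(3) by simp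
qed

lemma cone_preserving_spectral_radius:
  fixes M :: "real^'n^'n"
  assumes K: "proper_cone K" and M: "\<And>x. x \<in> K \<Longrightarrow> M *v x \<in> K"
    and v: "v \<in> interior K" "v \<noteq> 0" "M *v v = l *\<^sub>R v" "l \<ge> 0"
  shows "matrix_spectral_radius M = l"
  unfolding matrix_spectral_radius_def
proof (rule Max_eqI)
  have "complex_of_real l \<in> matrix_spectrum (map_matrix complex_of_real M)"
    using v by (intro real_eigenvalue_in_complex_spectrum[of M v])
      (simp add: is_eigenvector_def scalar_mult_eq_scaleR)
  then have "cmod (complex_of_real l) \<in> cmod ` matrix_spectrum (map_matrix complex_of_real M)"
    by (rule imageI)
  then show "l \<in> cmod ` matrix_spectrum (map_matrix complex_of_real M)"
    using v(4) by simp
qed (use cone_preserving_spectrum_bound[OF K M v(1,3,4)] finite_matrix_spectrum in auto)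

text \<open>The line through \<open>v\<close> in direction \<open>w\<close> leaves \<open>K\<close>, since otherwise \<open>K\<close> would contain both \<open>w\<close>
  and \<open>- w\<close>. Where it crosses the boundary there is a vector of \<open>K\<close> in the eigenspace but not interior;
  by hypothesis this can only be \<open>0\<close>, and then \<open>w\<close> is a multiple of \<open>v\<close>.\<close>

lemma eigenspace_one_dimensional:
  fixes M :: "real^'n^'n"
  assumes K: "proper_cone K"
    and int: "\<And>x. x \<in> K \<Longrightarrow> x \<noteq> 0 \<Longrightarrow> M *v x = l *\<^sub>R x \<Longrightarrow> x \<in> interior K"
    and v: "v \<in> K" "v \<noteq> 0" "M *v v = l *\<^sub>R v" and w: "M *v w = l *\<^sub>R w"
  obtains c where "w = c *\<^sub>R v"
proof (cases "w = 0")
  case True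
  then show ?thesis using that[of 0] by simp
next
  case False
  note Kd = proper_cone_dest[OF K]
  let ?L = "range (\<lambda>s. v + s *\<^sub>R w)"
  have "\<not> ?L \<subseteq> K"
  proof
    assume L: "?L \<subseteq> K"
    \<comment> \<open>A closed cone contains the direction of every ray it contains. This is used for \<open>w\<close> and for \<open>- w\<close>.\<close>
    have "w \<in> K" if w: "range (\<lambda>s. v + s *\<^sub>R w) \<subseteq> K" for w
    proof (rule closed_sequentially[OF Kd(1)])
      fix n
      have "(1 / real (Suc n)) *\<^sub>R (v + real (Suc n) *\<^sub>R w) \<in> K"
        using w by (intro convex_cone_scaleR Kd) auto
      then show "(1 / real (Suc n)) *\<^sub>R v + w \<in> K"
        by (simp add: scaleR_add_right del: of_nat_Suc)
    next
      have "(\<lambda>n. (1 / real (Suc n)) *\<^sub>R v + w) \<longlonglongrightarrow> 0 *\<^sub>R v + w"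
        using LIMSEQ_inverse_real_of_nat
        by (intro tendsto_intros) (simp add: inverse_eq_divide)
      then show "(\<lambda>n. (1 / real (Suc n)) *\<^sub>R v + w) \<longlonglongrightarrow> w" by simp
    qed
    moreover have "range (\<lambda>s. v + s *\<^sub>R (- w)) \<subseteq> K"
    proof clarify
      fix s show "v + s *\<^sub>R (- w) \<in> K"
        using subsetD[OF L rangeI[of _ "- s"]] by simp
    qed
    ultimately show False using L Kd(6) False by blast
  qed
  moreover have "v + 0 *\<^sub>R w \<in> ?L" by (rule rangeI)
  then have "?L \<inter> K \<noteq> {}" using v(1) by auto
  moreover have "connected ?L"
    by (intro connected_continuous_image continuous_intros) auto
  ultimately have "?L \<inter> frontier K \<noteq> {}"
    by (intro connected_Int_frontier) auto
  then obtain s where s: "v + s *\<^sub>R w \<in> K" "v + s *\<^sub>R w \<notin> interior K"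
    using Kd(1) by (auto simp: frontier_def)
  have "M *v (v + s *\<^sub>R w) = l *\<^sub>R (v + s *\<^sub>R w)"
    using v(3) w by (simp add: algebra_simps)
  then have z: "v + s *\<^sub>R w = 0"
    using int s by blast
  then have "s \<noteq> 0" using v(2) by auto
  moreover have "s *\<^sub>R w = - v" using z by (simp add: eq_neg_iff_add_eq_0 add.commute)
  ultimately have "w = (- 1 / s) *\<^sub>R v"
    by (metis divideR_right divide_inverse mult_minus1 scaleR_minus_left scaleR_minus_right)
  then show ?thesis using that by blast
qed

section \<open>Irreducible families\<close>

text \<open>The subspace \<open>V\<close> below is the span of the face of \<open>K\<close> generated by \<open>v\<close>. It is invariant
  under each \<open>A i\<close> separately because \<open>A i v\<close> is at most the sum of all \<open>A j v\<close>, a multiple of \<open>v\<close>.\<close>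

lemma irreducible_sum_eigenvector_interior:
  fixes A :: "'i \<Rightarrow> real^'n^'n"
  assumes fin: "finite I" and irr: "irreducible_family (A ` I)"
    and inv: "common_invariant_cone (A ` I) K"
    and v: "v \<in> K" "v \<noteq> 0" "(\<Sum>i\<in>I. A i) *v v = l *\<^sub>R v"
  shows "v \<in> interior K"
proof -
  have K: "proper_cone K" and AK: "\<And>i x. i \<in> I \<Longrightarrow> x \<in> K \<Longrightarrow> A i *v x \<in> K"
    using inv by (auto simp: common_invariant_cone_def)
  note Kd = proper_cone_dest[OF K]
  note add = convex_cone_add[OF Kd(3)] and scale = convex_cone_scaleR[OF Kd(3)]
  define V where "V = {x. \<exists>t\<ge>0. t *\<^sub>R v + x \<in> K \<and> t *\<^sub>R v - x \<in> K}"
  have "subspace V"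
  proof (rule subspaceI)
    show "0 \<in> V" using Kd(5) by (auto simp: V_def intro!: exI[of _ 0])
  next
    fix x y assume "x \<in> V" "y \<in> V"
    then obtain s t where "s \<ge> 0" "t \<ge> 0"
      "s *\<^sub>R v + x \<in> K" "s *\<^sub>R v - x \<in> K" "t *\<^sub>R v + y \<in> K" "t *\<^sub>R v - y \<in> K"
      by (auto simp: V_def)
    then have "s + t \<ge> 0" "(s + t) *\<^sub>R v + (x + y) \<in> K" "(s + t) *\<^sub>R v - (x + y) \<in> K"
      using add[of "s *\<^sub>R v + x" "t *\<^sub>R v + y"] add[of "s *\<^sub>R v - x" "t *\<^sub>R v - y"]
      by (simp_all add: algebra_simps)
    then show "x + y \<in> V" by (auto simp: V_def)
  next
    fix c x assume "x \<in> V"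
    then obtain t where t: "t \<ge> 0" "t *\<^sub>R v + x \<in> K" "t *\<^sub>R v - x \<in> K"
      by (auto simp: V_def)
    have "(\<bar>c\<bar> * t) *\<^sub>R v + c *\<^sub>R x \<in> K \<and> (\<bar>c\<bar> * t) *\<^sub>R v - c *\<^sub>R x \<in> K"
      using scale[of "\<bar>c\<bar>", OF _ t(2)] scale[of "\<bar>c\<bar>", OF _ t(3)]
      by (cases "c \<ge> 0") (simp_all add: algebra_simps minus_diff_commute)
    then show "c *\<^sub>R x \<in> V" using t(1) by (auto simp: V_def intro!: exI[of _ "\<bar>c\<bar> * t"])
  qed
  moreover have "A i *v x \<in> V" if i: "i \<in> I" and x: "x \<in> V" for i x
  proof -
    obtain t where t: "t \<ge> 0" "t *\<^sub>R v + x \<in> K" "t *\<^sub>R v - x \<in> K"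
      using x by (auto simp: V_def)
    define r where "r = (\<Sum>j\<in>I - {i}. A j *v v)"
    have "r \<in> K"
      unfolding r_def using AK v(1) by (intro convex_cone_sum[OF Kd(3)]) auto
    have "l *\<^sub>R v = (\<Sum>j\<in>I. A j *v v)"
      using v(3) by (simp add: matrix_vector_mult_sum_left)
    also have "\<dots> = A i *v v + r"
      using fin i by (simp add: r_def sum.remove)
    finally have lv: "l *\<^sub>R v = A i *v v + r" .
    have 1: "(t * l) *\<^sub>R v + A i *v x \<in> K" "(t * l) *\<^sub>R v - A i *v x \<in> K"
    proof -
      have tl: "(t * l) *\<^sub>R v = t *\<^sub>R (A i *v v) + t *\<^sub>R r"
        by (simp add: lv[symmetric] flip: scaleR_add_right)
      show "(t * l) *\<^sub>R v + A i *v x \<in> K"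
        unfolding tl using add[OF AK[OF i t(2)] scale[OF t(1) \<open>r \<in> K\<close>]]
        by (simp add: algebra_simps)
      show "(t * l) *\<^sub>R v - A i *v x \<in> K"
        unfolding tl using add[OF AK[OF i t(3)] scale[OF t(1) \<open>r \<in> K\<close>]]
        by (simp add: algebra_simps)
    qed
    \<comment> \<open>Passing to the absolute value avoids a separate argument that \<open>l\<close> is nonnegative.\<close>
    have 2: "(\<bar>t * l\<bar> - t * l) *\<^sub>R v \<in> K"
      using v(1) by (intro scale) auto
    have "\<bar>t * l\<bar> *\<^sub>R v + A i *v x \<in> K" "\<bar>t * l\<bar> *\<^sub>R v - A i *v x \<in> K"
      using add[OF 2 1(1)] add[OF 2 1(2)] by (simp_all add: scaleR_diff_left)
    then show ?thesis by (auto simp: V_def intro!: exI[of _ "\<bar>t * l\<bar>"])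
  qed
  ultimately have "V = {0} \<or> V = UNIV"
    using irr unfolding irreducible_family_def by (auto simp: image_subset_iff)
  moreover have "v \<in> V"
    using v(1) Kd(5) scale[of 2 v] by (auto simp: V_def scaleR_2 intro!: exI[of _ 1])
  ultimately have V: "V = UNIV" using v(2) by blast
  obtain w where w: "w \<in> interior K" using Kd(4) by blast
  obtain t where t: "t \<ge> 0" "t *\<^sub>R v - w \<in> K" using V by (auto simp: V_def)
  \<comment> \<open>Only a positive multiple of \<open>v\<close> can be scaled back to \<open>v\<close>, hence \<open>t + 1\<close> instead of \<open>t\<close>.\<close>
  have "(t + 1) *\<^sub>R v - w \<in> K"
    using add[OF t(2) v(1)] by (simp add: algebra_simps)
  then show ?thesis
    using absorbing_point_interior[OF Kd(3) w] t(1) by (metis add_nonneg_pos zero_less_one)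
qed

theorem theorem1:
  fixes A :: "nat \<Rightarrow> real^'n^'n" and m :: nat and K :: "(real^'n) set"
  assumes "m \<ge> 1"
    and "irreducible_family (A ` {1..m})"
    and "common_invariant_cone (A ` {1..m}) K"
  shows "(\<exists>v. perron_eigenvector K (mean_matrix m A) v) \<and>
         (\<forall>v. perron_eigenvector K (mean_matrix m A) v \<longrightarrow>
              simple_leading_eigenvector (mean_matrix m A) v \<and> v \<in> interior K)"
proof -
  let ?M = "mean_matrix m A" and ?S = "\<Sum>i=1..m. A i"
  have K: "proper_cone K" and AK: "\<And>i x. i \<in> {1..m} \<Longrightarrow> x \<in> K \<Longrightarrow> A i *v x \<in> K"
    using assms(3) unfolding common_invariant_cone_def by blast+
  note Kd = proper_cone_dest[OF K]
  have MS: "?M *v x = (1 / real m) *\<^sub>R (?S *v x)" for x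
    by (simp add: mean_matrix_def scaleR_matrix_vector_assoc)
  have "?S *v x \<in> K" if "x \<in> K" for x
    unfolding matrix_vector_mult_sum_left
    using AK that by (intro convex_cone_sum[OF Kd(3)])
  then have MK: "?M *v x \<in> K" if "x \<in> K" for x
    unfolding MS using that by (intro convex_cone_scaleR[OF Kd(3)]) simp_all
  have int: "x \<in> interior K" if "x \<in> K" "x \<noteq> 0" "?M *v x = l *\<^sub>R x" for x l
  proof (rule irreducible_sum_eigenvector_interior[OF _ assms(2,3) that(1,2)])
    have "?S *v x = real m *\<^sub>R (?M *v x)"
      using assms(1) by (simp add: MS)
    then show "?S *v x = (real m * l) *\<^sub>R x"
      by (simp add: that(3))
  qed simp
  obtain v0 l where v0: "v0 \<in> K" "v0 \<noteq> 0" "l \<ge> 0" "?M *v v0 = l *\<^sub>R v0"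
    using cone_preserving_eigenvector_exists[OF K MK] by blast
  have rho: "matrix_spectral_radius ?M = l"
    using cone_preserving_spectral_radius[OF K MK int[OF v0(1,2,4)] v0(2,4,3)] .
  have lead: "leading_eigenvector ?M x \<longleftrightarrow> x \<noteq> 0 \<and> ?M *v x = l *\<^sub>R x" for x
    by (simp add: leading_eigenvector_def is_eigenvector_def rho scalar_mult_eq_scaleR)
  have "perron_eigenvector K ?M v0"
    using v0 by (simp add: perron_eigenvector_def lead)
  moreover have "simple_leading_eigenvector ?M v \<and> v \<in> interior K"
    if "perron_eigenvector K ?M v" for v
  proof -
    have v: "v \<in> K" "v \<noteq> 0" "?M *v v = l *\<^sub>R v"
      using that by (auto simp: perron_eigenvector_def lead)
    have "\<exists>c. w = c *\<^sub>R v" if "leading_eigenvector ?M w" for w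
    proof -
      have "?M *v w = l *\<^sub>R w" using that lead by blast
      from eigenspace_one_dimensional[OF K _ v this] int show ?thesis by metis
    qed
    then show ?thesis
      using v int by (simp add: simple_leading_eigenvector_def lead)
  qed
  ultimately show ?thesis by blast
qed

end
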